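(* Let $\langle T,\sqsubseteq\rangle$ be a normal Souslin tree, let $\preceq$ be a total order on $T$, and let $\leq$ be the lexicographic total order on $T$ determined by $\sqsubseteq$ and $\preceq$ (as defined in the context). Then the Souslin line $\langle T,\leq\rangle$, with its order topology, is functionally countable and exponentially separable.
   Context: A tree is a partially ordered set $\langle T,\sqsubseteq\rangle$ such that for every $x\in T$ the set $x{\downarrow}=\{y\in T: y\sqsubset x\}$ is well-ordered by $\sqsubseteq$; the height of $x$ is the order type of $x{\downarrow}$, $T_\alpha$ is the set of elements of height $\alpha$, and the height of $T$ is the least $\beta$ with $T_\beta=\emptyset$. An $\omega_1$-tree is a tree of height $\omega_1$ all of whose levels $T_\alpha$ are countable. A Souslin tree is an $\omega_1$-tree with no uncountable chains and no uncountable antichains (an antichain is a set of pairwise $\sqsubseteq$-incomparable elements). A tree $T$ of height $\kappa$ is normal if: (i) $|T_0|=1$; (ii) for all $\alpha$ with $\alpha+1<\kappa$ and $x\in T_\alpha$ there are distinct $y_0,y_1\in T_{\alpha+1}$ with $x\sqsubset y_0$ and $x\sqsubset y_1$; (iii) if $\alpha<\beta<\kappa$ and $x\in T_\alpha$, there is $y\in T_\beta$ with $x\sqsubset y$; (iv) if $\alpha<\kappa$ is a limit ordinal and $x,y\in T_\alpha$ satisfy $x{\downarrow}=y{\downarrow}$, then $x=y$. Lexicographic order: for $s,t\in T$ write $s\perp t$ if $s\not\sqsubseteq t$ and $t\not\sqsubseteq s$. If $s\perp t$ in a normal tree, then $s{\downarrow}\cap t{\downarrow}$ has a maximum element $s\wedge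 t$, and we let $s_{s\wedge t}$ and $t_{s\wedge t}$ be the immediate successors of $s\wedge t$ in $T$ with $s_{s\wedge t}\sqsubseteq s$ and $t_{s\wedge t}\sqsubseteq t$. Define $s\leq t$ if either $s\sqsubseteq t$, or $s\perp t$ and $s_{s\wedge t}\prec t_{s\wedge t}$. This is a total order on $T$, and it is well known that when $T$ is a Souslin tree $\langle T,\leq\rangle$ is a Souslin line, i.e. its order topology is ccc and not separable. A space $X$ is functionally countable if $f[X]$ is countable for every continuous $f\colon X\to\mathbb{R}$. Given a family $\mathcal{F}$ of subsets of $X$, a set $A\subset X$ is strongly dense in $\mathcal{F}$ if $A\cap\bigcap\mathcal{G}\neq\emptyset$ whenever $\mathcal{G}\subset\mathcal{F}$ and $\bigcap\mathcal{G}\neq\emptyset$. $X$ is exponentially separable if for every countable family $\mathcal{F}$ of closed subsets of $X$ there is a countable $A\subset X$ that is strongly dense in $\mathcal{F}$. *)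

theory Defs
  imports "HOL-Analysis.Analysis" "HOL-Library.Countable_Set_Type"
begin

unbundle cardinal_syntax

section \<open>Ordinals\<close>

text \<open>
  Ordinals are represented by well-order relations up to the isomorphism \<open>=o\<close>. Every ordinal
  below a well-order on a type is realised by a well-order on the same type, so bounded
  quantification over ordinals stays inside one type.
\<close>

definition omega1 :: "nat set rel" where
  "omega1 = cardSuc natLeq"

definition is_ord_succ :: "'b rel \<Rightarrow> 'b rel \<Rightarrow> bool" where
  "is_ord_succ \<alpha> \<beta> \<longleftrightarrow> \<alpha> <o \<beta> \<and> \<not> (\<exists>\<gamma> :: 'b rel. \<alpha> <o \<gamma> \<and> \<gamma> <o \<beta>)"

definition limit_ord :: "'b rel \<Rightarrow> bool" where
  "limit_ord \<alpha> \<longleftrightarrow> Well_order \<alpha> \<and> \<alpha> \<noteq> {} \<and> \<not> (\<exists>\<beta>. is_ord_succ \<beta> \<alpha>)"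

lemma less_omega1_iff:
  "\<alpha> <o omega1 \<longleftrightarrow> Well_order \<alpha> \<and> countable (Field \<alpha>)"
proof
  assume L: "\<alpha> <o omega1"
  then have W: "Well_order \<alpha>"
    by (simp add: ordLess_def)
  have "|Field \<alpha>| <o cardSuc natLeq"
    using L card_of_least[OF W] ordLeq_ordLess_trans
    unfolding omega1_def by blast
  then have "|Field \<alpha>| \<le>o natLeq"
    using cardSuc_ordLeq_ordLess[OF natLeq_Card_order card_of_Card_order] by blast
  then show "Well_order \<alpha> \<and> countable (Field \<alpha>)"
    using W by (simp add: countable_card_le_natLeq)
next
  assume R: "Well_order \<alpha> \<and> countable (Field \<alpha>)"
  have C: "Card_order omega1"
    unfolding omega1_def by (simp add: cardSuc_Card_order natLeq_Card_order)
  have lt: "|Field \<alpha>| <o omega1"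
    using R cardSuc_greater[OF natLeq_Card_order] ordLeq_ordLess_trans
    unfolding omega1_def countable_card_le_natLeq by blast
  show "\<alpha> <o omega1"
  proof (rule ccontr)
    assume "\<not> \<alpha> <o omega1"
    then have "omega1 \<le>o \<alpha>"
      using C R card_order_on_well_order_on ordLess_or_ordLeq by blast
    then have "|Field omega1| \<le>o |Field \<alpha>|"
      by (rule card_of_mono2)
    then show False
      using lt card_of_Field_ordIso[OF C] not_ordLess_ordLeq ordIso_symmetric
        ordIso_ordLeq_trans by blast
  qed
qed

section \<open>Trees\<close>

text \<open>
  A tree has carrier \<open>T\<close> and (reflexive) order relation \<open>r \<subseteq> T \<times> T\<close>;
  the set of strict predecessors of \<open>x\<close> is \<^term>\<open>underS r x\<close>.
\<close>

definition is_tree :: "'a set \<Rightarrow> 'a rel \<Rightarrow> bool" where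
  "is_tree T r \<longleftrightarrow> partial_order_on T r \<and>
     (\<forall>x\<in>T. well_order_on (underS r x) (Restr r (underS r x)))"

definition tree_level :: "'a set \<Rightarrow> 'a rel \<Rightarrow> 'b rel \<Rightarrow> 'a set" where
  "tree_level T r \<alpha> = {x \<in> T. Restr r (underS r x) =o \<alpha>}"

definition has_height :: "'a set \<Rightarrow> 'a rel \<Rightarrow> 'b rel \<Rightarrow> bool" where
  "has_height T r \<kappa> \<longleftrightarrow> Well_order \<kappa> \<and> tree_level T r \<kappa> = {} \<and>
     (\<forall>\<alpha> :: 'b rel. \<alpha> <o \<kappa> \<longrightarrow> tree_level T r \<alpha> \<noteq> {})"

definition omega1_tree :: "'a set \<Rightarrow> 'a rel \<Rightarrow> bool" where
  "omega1_tree T r \<longleftrightarrow> is_tree T r \<and> has_height T r omega1 \<and>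
     (\<forall>\<alpha> :: nat set rel. countable (tree_level T r \<alpha>))"

definition incomp :: "'a rel \<Rightarrow> 'a \<Rightarrow> 'a \<Rightarrow> bool" where
  "incomp r s t \<longleftrightarrow> (s, t) \<notin> r \<and> (t, s) \<notin> r"

definition souslin_tree :: "'a set \<Rightarrow> 'a rel \<Rightarrow> bool" where
  "souslin_tree T r \<longleftrightarrow> omega1_tree T r \<and>
     (\<forall>C \<in> Chains r. countable C) \<and>
     (\<forall>A. A \<subseteq> T \<and> pairwise (incomp r) A \<longrightarrow> countable A)"

definition normal_tree :: "'a set \<Rightarrow> 'a rel \<Rightarrow> 'b rel \<Rightarrow> bool" where
  "normal_tree T r \<kappa> \<longleftrightarrow> is_tree T r \<and> has_height T r \<kappa> \<and>
     card (tree_level T r ({} :: 'b rel)) = 1 \<and>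
     (\<forall>(\<alpha> :: 'b rel) (\<beta> :: 'b rel). is_ord_succ \<alpha> \<beta> \<and> \<beta> <o \<kappa> \<longrightarrow>
        (\<forall>x \<in> tree_level T r \<alpha>. \<exists>y0 \<in> tree_level T r \<beta>. \<exists>y1 \<in> tree_level T r \<beta>.
           y0 \<noteq> y1 \<and> x \<in> underS r y0 \<and> x \<in> underS r y1)) \<and>
     (\<forall>(\<alpha> :: 'b rel) (\<beta> :: 'b rel). \<alpha> <o \<beta> \<and> \<beta> <o \<kappa> \<longrightarrow>
        (\<forall>x \<in> tree_level T r \<alpha>. \<exists>y \<in> tree_level T r \<beta>. x \<in> underS r y)) \<and>
     (\<forall>\<alpha> :: 'b rel. limit_ord \<alpha> \<and> \<alpha> <o \<kappa> \<longrightarrow>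
        (\<forall>x \<in> tree_level T r \<alpha>. \<forall>y \<in> tree_level T r \<alpha>.
           underS r x = underS r y \<longrightarrow> x = y))"

section \<open>The lexicographic order\<close>

definition tree_meet :: "'a rel \<Rightarrow> 'a \<Rightarrow> 'a \<Rightarrow> 'a" where
  "tree_meet r s t = (THE m. m \<in> underS r s \<inter> underS r t \<and>
     (\<forall>z \<in> underS r s \<inter> underS r t. (z, m) \<in> r))"

text \<open>The immediate successor of \<open>w\<close> lying below or equal to \<open>s\<close>.\<close>

definition succ_towards :: "'a rel \<Rightarrow> 'a \<Rightarrow> 'a \<Rightarrow> 'a" where
  "succ_towards r w s = (THE y. (y, s) \<in> r \<and> w \<in> underS r y \<and>
     \<not> (\<exists>z. w \<in> underS r z \<and> z \<in> underS r y))"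

definition lex_order :: "'a set \<Rightarrow> 'a rel \<Rightarrow> 'a rel \<Rightarrow> 'a rel" where
  "lex_order T r p = {(s, t). s \<in> T \<and> t \<in> T \<and>
     ((s, t) \<in> r \<or>
      incomp r s t \<and>
        succ_towards r (tree_meet r s t) s \<in> underS p (succ_towards r (tree_meet r s t) t))}"

section \<open>Topological notions\<close>

text \<open>
  The carrier is added to the subbase of open rays so that a one-point order gets
  the right topology.
\<close>

definition order_topology_on :: "'a set \<Rightarrow> 'a rel \<Rightarrow> 'a topology" where
  "order_topology_on T L =
     topology_generated_by (insert T (underS L ` T \<union> aboveS L ` T))"

lemma topspace_order_topology_on:
  "linear_order_on T L \<Longrightarrow> topspace (order_topology_on T L) = T"
  unfolding order_topology_on_def topology_generated_by_topspace underS_def aboveS_def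
  by (auto simp: order_on_defs)

definition functionally_countable :: "'a topology \<Rightarrow> bool" where
  "functionally_countable X \<longleftrightarrow>
     (\<forall>f. continuous_map X euclideanreal f \<longrightarrow> countable (f ` topspace X))"

text \<open>
  The intersection of the empty subfamily is the whole space, hence the intersection
  with \<^term>\<open>topspace X\<close>.
\<close>

definition strongly_dense_in :: "'a topology \<Rightarrow> 'a set set \<Rightarrow> 'a set \<Rightarrow> bool" where
  "strongly_dense_in X \<F> A \<longleftrightarrow>
     (\<forall>\<G>. \<G> \<subseteq> \<F> \<and> topspace X \<inter> \<Inter>\<G> \<noteq> {} \<longrightarrow> A \<inter> (topspace X \<inter> \<Inter>\<G>) \<noteq> {})"

definition exponentially_separable :: "'a topology \<Rightarrow> bool" where
  "exponentially_separable X \<longleftrightarrow>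
     (\<forall>\<F>. countable \<F> \<and> (\<forall>C\<in>\<F>. closedin X C) \<longrightarrow>
        (\<exists>A. A \<subseteq> topspace X \<and> countable A \<and> strongly_dense_in X \<F> A))"

end

theory Submission
  imports Defs
begin

text \<open>
  Functional countability follows from exponential separability applied to the preimages of
  closed intervals with rational endpoints, whose intersections include all fibres of the map.

  For exponential separability, let \<open>F\<close> be closed. Call \<open>z\<close> a non-least child if it is an immediate
  successor of some \<open>w\<close> having a \<open>p\<close>-smaller immediate successor. Every neighbourhood of such a
  \<open>z\<close> contains a whole cone above \<open>w\<close>, because \<open>z\<close> is approached from the left by cones. Hence the
  nodes \<open>y\<close> whose cone misses \<open>F\<close>, or all of whose non-least children above \<open>y\<close> lie in \<open>F\<close>,
  form a dense upward closed subset of the tree, and such a set is co-countable since its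
  minimal elements form a countable antichain. For a countable family of closed sets, the
  co-countable intersection \<open>E\<close> of these subsets yields the required countable set: the nodes
  outside \<open>E\<close>, together with one non-least child of each minimal element of \<open>E\<close>.
\<close>

section \<open>Continuous real-valued images of exponentially separable spaces\<close>

lemma exponentially_separable_imp_functionally_countable:
  assumes "exponentially_separable X"
  shows "functionally_countable X"
  unfolding functionally_countable_def
proof (intro allI impI)
  fix f assume f: "continuous_map X euclideanreal f"
  define R where "R a b = {x \<in> topspace X. f x \<in> {a..b}}" for a b
  define \<F> where "\<F> = (\<lambda>(a, b). R a b) ` (\<rat> \<times> \<rat>)"
  have "countable \<F>"
    unfolding \<F>_def by (intro countable_image countable_SIGMA countable_rat)
  moreover have "closedin X C" if "C \<in> \<F>" for C
  proof -
    obtain a b where "C = R a b"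
      using \<open>C \<in> \<F>\<close> by (auto simp: \<F>_def)
    then show ?thesis
      using closedin_continuous_map_preimage[OF f, of "{a..b}"] by (simp add: R_def)
  qed
  ultimately obtain A where A: "A \<subseteq> topspace X" "countable A" "strongly_dense_in X \<F> A"
    using assms unfolding exponentially_separable_def by blast
  have "f ` topspace X \<subseteq> f ` A"
  proof (rule image_subsetI)
    fix x assume x: "x \<in> topspace X"
    \<comment> \<open>The common part of all members of \<open>\<F>\<close> through \<open>x\<close>
      is the fibre of \<open>f\<close> over \<open>f x\<close>, so a strongly dense \<open>A\<close>
      meets every fibre and \<open>f\<close> takes all its values on \<open>A\<close>.\<close>
    define \<G> where "\<G> = {C \<in> \<F>. x \<in> C}"
    have "x \<in> topspace X \<inter> \<Inter>\<G>"
      using x by (auto simp: \<G>_def)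
    moreover have "\<G> \<subseteq> \<F>"
      by (auto simp: \<G>_def)
    ultimately obtain y where y: "y \<in> A" "y \<in> \<Inter>\<G>"
      using A(3) unfolding strongly_dense_in_def by blast
    have between: "a \<le> f y \<and> f y \<le> b"
      if "a \<in> \<rat>" "b \<in> \<rat>" "a \<le> f x" "f x \<le> b" for a b
    proof -
      have "R a b \<in> \<G>"
        unfolding \<G>_def \<F>_def
      proof (intro CollectI conjI)
        have "(a, b) \<in> \<rat> \<times> \<rat>"
          using that by simp
        then show "R a b \<in> (\<lambda>(a, b). R a b) ` (\<rat> \<times> \<rat>)"
          by (metis (mono_tags) case_prod_conv imageI)
        show "x \<in> R a b"
          using that x by (simp add: R_def)
      qed
      then show ?thesis
        using y by (auto simp: R_def)
    qed
    \<comment> \<open>Members of \<open>\<F>\<close> bound \<open>f\<close> on both sides, so a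
      one-sided rational bound is obtained by adding an arbitrary rational endpoint on the other
      side.\<close>
    have lower: "a \<le> f y" if a: "a \<in> \<rat>" "a \<le> f x" for a
    proof -
      obtain b where "b \<in> \<rat>" "f x < b"
        using Rats_dense_in_real[of "f x" "f x + 1"] by auto
      then show ?thesis
        using between[of a b] a by simp
    qed
    have upper: "f y \<le> b" if b: "b \<in> \<rat>" "f x \<le> b" for b
    proof -
      obtain a where "a \<in> \<rat>" "a < f x"
        using Rats_dense_in_real[of "f x - 1" "f x"] by auto
      then show ?thesis
        using between[of a b] b by simp
    qed
    have "f y = f x"
    proof (rule antisym)
      show "f y \<le> f x"
      proof (rule ccontr)
        assume "\<not> f y \<le> f x"
        then obtain b where "b \<in> \<rat>" "f x < b" "b < f y"
          using Rats_dense_in_real[of "f x" "f y"] by auto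
        then show False
          using upper[of b] by simp
      qed
      show "f x \<le> f y"
      proof (rule ccontr)
        assume "\<not> f x \<le> f y"
        then obtain a where "a \<in> \<rat>" "f y < a" "a < f x"
          using Rats_dense_in_real[of "f y" "f x"] by auto
        then show False
          using lower[of a] by simp
      qed
    qed
    then show "f x \<in> f ` A"
      using y(1) by (metis imageI)
  qed
  then show "countable (f ` topspace X)"
    by (rule countable_subset) (intro countable_image A(2))
qed

section \<open>Countable ordinals\<close>

text \<open>An infinite cardinal has no last element. If \<alpha> is the segment of
  \<open>omega1\<close> below \<open>a\<close>, a larger element \<open>b\<close> gives a segment
  that exceeds \<alpha> and is still below \<open>omega1\<close>; the least ordinal above \<alpha>
  is at most this segment.\<close>

lemma ord_succ_below_omega1:
  fixes \<alpha> :: "nat set rel"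
  assumes "\<alpha> <o omega1"
  obtains \<beta> :: "nat set rel" where "is_ord_succ \<alpha> \<beta>" "\<beta> <o omega1"
proof -
  have C: "Card_order omega1"
    unfolding omega1_def by (rule cardSuc_Card_order[OF natLeq_Card_order])
  have inf: "\<not> finite (Field omega1)"
    unfolding omega1_def using cardSuc_finite[OF natLeq_Card_order]
    by (simp add: Field_natLeq)
  have W: "Well_order omega1"
    using C card_order_on_well_order_on by blast
  obtain a where a: "a \<in> Field omega1" "\<alpha> =o Restr omega1 (underS omega1 a)"
    using assms W ordLess_iff_ordIso_Restr unfolding ordLess_def by blast
  obtain b where b: "b \<in> Field omega1" "(b, a) \<notin> omega1"
    using Card_order_infinite_not_under[OF C inf] under_Field[of omega1 a]
    unfolding under_def by blast
  then have ab: "(a, b) \<in> omega1" "a \<noteq> b"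
    using W a unfolding order_on_defs total_on_def refl_on_def by (metis, metis)
  let ?B = "Restr omega1 (underS omega1 b)"
  have "a \<in> underS omega1 b"
    using ab by (auto simp: underS_def)
  then have sub: "underS omega1 a \<subset> underS omega1 b"
    using W unfolding order_on_defs underS_def trans_def antisym_def by blast
  have of: "wo_rel.ofilter omega1 (underS omega1 x)" for x
    using W by (simp add: wo_rel_def wo_rel.underS_ofilter)
  have "Restr omega1 (underS omega1 a) <o ?B"
    using ofilter_subset_ordLess[OF W of of] sub by blast
  then have "\<alpha> <o ?B"
    using a ordIso_ordLess_trans by blast
  then have "?B \<in> {\<gamma>. \<alpha> <o \<gamma>}"
    by simp
  from wfE_min[OF wf_ordLess this] obtain \<beta> :: "nat set rel"
    where \<beta>: "\<alpha> <o \<beta>" "\<And>\<gamma> :: nat set rel. \<gamma> <o \<beta> \<Longrightarrow> \<not> \<alpha> <o \<gamma>"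
    by (metis mem_Collect_eq)
  have "\<beta> \<le>o ?B"
  proof (rule ccontr)
    assume "\<not> \<beta> \<le>o ?B"
    moreover have "Well_order \<beta>" "Well_order ?B"
      using \<beta>(1) \<open>\<alpha> <o ?B\<close> unfolding ordLess_def by blast+
    ultimately have "?B <o \<beta>"
      using not_ordLeq_iff_ordLess by blast
    then show False
      using \<beta>(2) \<open>\<alpha> <o ?B\<close> by blast
  qed
  moreover have "?B <o omega1"
    using underS_Restr_ordLess[OF W] b by blast
  ultimately have "\<beta> <o omega1"
    using ordLeq_ordLess_trans by blast
  moreover have "is_ord_succ \<alpha> \<beta>"
    using \<beta> unfolding is_ord_succ_def by blast
  ultimately show ?thesis
    using that by blast
qed

text \<open>Heights of nodes are relations on the type of the nodes, whereas normality speaks of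
  levels indexed by relations on \<open>nat set\<close>. Enumerating the field and taking singletons
  transports a countable well-order to that type.\<close>

lemma countable_well_order_ordIso_nat_set:
  fixes \<rho> :: "'a rel"
  assumes "Well_order \<rho>" "countable (Field \<rho>)"
  obtains \<alpha> :: "nat set rel" where "\<rho> =o \<alpha>" "\<alpha> <o omega1"
proof -
  define g where "g = (\<lambda>x. {to_nat_on (Field \<rho>) x})"
  have g: "inj_on g (Field \<rho>)"
    using inj_on_to_nat_on[OF assms(2)] unfolding g_def inj_on_def by simp
  have iso: "\<rho> =o dir_image \<rho> g"
    by (rule dir_image_ordIso[OF assms(1) g])
  have "countable (Field (dir_image \<rho> g))"
    using assms(2) by (simp add: dir_image_Field)
  then have "dir_image \<rho> g <o omega1"
    using Well_order_dir_image[OF assms(1) g] less_omega1_iff by blast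
  then show ?thesis
    using that iso by blast
qed

section \<open>Normal Souslin trees\<close>

locale souslin_lex =
  fixes T :: "'a set" and r p :: "'a rel"
  assumes souslin: "souslin_tree T r"
    and normal: "normal_tree T r omega1"
    and linear: "linear_order_on T p"
begin

abbreviation tree_le (infix "\<sqsubseteq>" 50) where
  "x \<sqsubseteq> y \<equiv> (x, y) \<in> r"

abbreviation tree_less (infix "\<sqsubset>" 50) where
  "x \<sqsubset> y \<equiv> x \<in> underS r y"

abbreviation height_of :: "'a \<Rightarrow> 'a rel" where
  "height_of x \<equiv> Restr r (underS r x)"

lemma partial_order: "partial_order_on T r"
  using normal by (simp add: normal_tree_def is_tree_def)

lemma less_iff: "x \<sqsubset> y \<longleftrightarrow> x \<sqsubseteq> y \<and> x \<noteq> y"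
  by (auto simp: underS_def)

lemma le_carrier: "x \<sqsubseteq> y \<Longrightarrow> x \<in> T \<and> y \<in> T"
  using partial_order by (auto simp: order_on_defs)

lemma le_refl: "x \<in> T \<Longrightarrow> x \<sqsubseteq> x"
  using partial_order by (auto simp: order_on_defs refl_on_def)

lemma le_trans: "x \<sqsubseteq> y \<Longrightarrow> y \<sqsubseteq> z \<Longrightarrow> x \<sqsubseteq> z"
  using partial_order unfolding order_on_defs trans_def by blast

lemma le_antisym: "x \<sqsubseteq> y \<Longrightarrow> y \<sqsubseteq> x \<Longrightarrow> x = y"
  using partial_order unfolding order_on_defs antisym_def by blast

lemma less_le_trans: "x \<sqsubset> y \<Longrightarrow> y \<sqsubseteq> z \<Longrightarrow> x \<sqsubset> z"
  using le_trans le_antisym unfolding less_iff by blast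

lemma le_less_trans: "x \<sqsubseteq> y \<Longrightarrow> y \<sqsubset> z \<Longrightarrow> x \<sqsubset> z"
  using le_trans le_antisym unfolding less_iff by blast

lemma well_order_below: "x \<in> T \<Longrightarrow> well_order_on (underS r x) (height_of x)"
  using normal by (simp add: normal_tree_def is_tree_def)

lemma Field_height_of: "x \<in> T \<Longrightarrow> Field (height_of x) = underS r x"
  using well_order_below well_order_on_Field by metis

lemma Well_order_height_of: "x \<in> T \<Longrightarrow> Well_order (height_of x)"
  using well_order_below well_order_on_Well_order by blast

lemma comparable:
  assumes "x \<sqsubseteq> z" "y \<sqsubseteq> z"
  shows "x \<sqsubseteq> y \<or> y \<sqsubseteq> x"
proof (cases "x = z \<or> y = z \<or> x = y")
  case True
  then show ?thesis
    using assms le_refl le_carrier by blast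
next
  case False
  have "total_on (underS r z) (height_of z)"
    using well_order_below assms le_carrier unfolding order_on_defs by blast
  moreover have "x \<sqsubset> z" "y \<sqsubset> z"
    using False assms by (auto simp: less_iff)
  ultimately show ?thesis
    using False unfolding total_on_def by blast
qed

text \<open>The well-order on the strict predecessors of \<open>a\<close> does not see
  \<open>a\<close> itself, so the case in which none of them lies in \<open>A\<close> is separate:
  there \<open>a\<close> is already minimal.\<close>

lemma minimal_below:
  assumes "a \<in> A" "A \<subseteq> T"
  obtains m where "m \<in> A" "m \<sqsubseteq> a" "\<And>z. z \<sqsubset> m \<Longrightarrow> z \<notin> A"
proof (cases "A \<inter> underS r a = {}")
  case True
  then show ?thesis
    using that[of a] assms le_refl by blast
next
  case False
  have "wf (height_of a - Id)"
    using well_order_below assms by (auto simp: well_order_on_def)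
  then obtain m where m: "m \<in> A \<inter> underS r a"
    "\<And>z. (z, m) \<in> height_of a - Id \<Longrightarrow> z \<notin> A \<inter> underS r a"
    using False unfolding wf_eq_minimal by (metis ex_in_conv)
  show ?thesis
  proof (rule that[of m])
    show "z \<notin> A" if "z \<sqsubset> m" for z
    proof -
      have "z \<sqsubset> a" "(z, m) \<in> height_of a - Id"
        using m(1) that le_less_trans[of z m a] by (auto simp: less_iff)
      then show ?thesis
        using m(2) by blast
    qed
  qed (use m in \<open>auto simp: less_iff\<close>)
qed

lemma countable_below: "countable (underS r x)"
proof -
  have "underS r x \<in> Chains r"
    unfolding Chains_def less_iff using comparable less_iff by blast
  then show ?thesis
    using souslin by (simp add: souslin_tree_def)
qed

lemma countable_antichain: "A \<subseteq> T \<Longrightarrow> pairwise (incomp r) A \<Longrightarrow> countable A"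
  using souslin by (simp add: souslin_tree_def)

lemma height_of_restrict:
  assumes xy: "x \<sqsubset> y"
  shows "Restr (height_of y) (underS (height_of y) x) = height_of x"
proof -
  have sub: "underS r x \<subseteq> underS r y"
  proof
    fix u assume "u \<sqsubset> x"
    then show "u \<sqsubset> y"
      using xy less_le_trans[of u x y] unfolding less_iff by blast
  qed
  then have "underS (height_of y) x = underS r x"
    using xy unfolding underS_def by blast
  then show ?thesis
    using sub by auto
qed

lemma height_of_less: "x \<sqsubset> y \<Longrightarrow> height_of x <o height_of y"
proof -
  assume xy: "x \<sqsubset> y"
  then have y: "y \<in> T"
    using le_carrier by (auto simp: less_iff)
  show ?thesis
    using height_of_restrict[OF xy] underS_Restr_ordLess[OF Well_order_height_of[OF y], of x]
      Field_height_of[OF y] xy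
    by auto
qed

lemma level_index:
  assumes "x \<in> T"
  obtains \<alpha> :: "nat set rel" where "height_of x =o \<alpha>" "\<alpha> <o omega1"
  using countable_well_order_ordIso_nat_set[OF Well_order_height_of[OF assms]]
    Field_height_of[OF assms] countable_below by metis

section \<open>Immediate successors and the levels of the tree\<close>

definition imm_succ :: "'a \<Rightarrow> 'a \<Rightarrow> bool" where
  "imm_succ w y \<longleftrightarrow> w \<sqsubset> y \<and> (\<forall>z. w \<sqsubset> z \<longrightarrow> \<not> z \<sqsubset> y)"

text \<open>Normality provides two nodes above \<open>x\<close> on the next level. They are
  immediate successors because a node strictly in between would have a height strictly between an
  ordinal and its successor.\<close>

lemma two_imm_succs:
  assumes "x \<in> T"
  obtains y0 y1 where "imm_succ x y0" "imm_succ x y1" "y0 \<noteq> y1"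
proof -
  obtain \<alpha> :: "nat set rel" where \<alpha>: "height_of x =o \<alpha>" "\<alpha> <o omega1"
    using level_index assms by blast
  obtain \<beta> where \<beta>: "is_ord_succ \<alpha> \<beta>" "\<beta> <o omega1"
    using ord_succ_below_omega1 \<alpha> by blast
  have "x \<in> tree_level T r \<alpha>"
    using assms \<alpha> by (simp add: tree_level_def)
  then obtain y0 y1 where y: "y0 \<in> tree_level T r \<beta>" "y1 \<in> tree_level T r \<beta>"
    "y0 \<noteq> y1" "x \<sqsubset> y0" "x \<sqsubset> y1"
    using normal \<beta> unfolding normal_tree_def by meson
  have imm: "imm_succ x y" if "y \<in> tree_level T r \<beta>" "x \<sqsubset> y" for y
    unfolding imm_succ_def
  proof (intro conjI allI impI notI)
    fix z assume z: "x \<sqsubset> z" "z \<sqsubset> y"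
    then have "z \<in> T"
      using le_carrier by (auto simp: less_iff)
    then obtain \<gamma> :: "nat set rel" where \<gamma>: "height_of z =o \<gamma>"
      using level_index by blast
    have "height_of y =o \<beta>"
      using that by (simp add: tree_level_def)
    then have "\<alpha> <o \<gamma>" "\<gamma> <o \<beta>"
      using height_of_less[OF z(1)] height_of_less[OF z(2)] \<gamma> \<alpha>(1)
      by (meson ordIso_symmetric ordIso_ordLess_trans ordLess_ordIso_trans)+
    then show False
      using \<beta>(1) unfolding is_ord_succ_def by blast
  qed (fact that)
  show ?thesis
    using that imm y by blast
qed

lemma imm_succ_unique:
  "imm_succ w y \<Longrightarrow> imm_succ w z \<Longrightarrow> y \<sqsubseteq> t \<Longrightarrow> z \<sqsubseteq> t \<Longrightarrow> y = z"
  unfolding imm_succ_def using comparable less_iff by metis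

lemma imm_succ_le:
  "imm_succ w y \<Longrightarrow> y \<sqsubseteq> t \<Longrightarrow> w \<sqsubset> z \<Longrightarrow> z \<sqsubseteq> t \<Longrightarrow> y \<sqsubseteq> z"
  unfolding imm_succ_def using comparable less_iff by metis

text \<open>Distinct nodes with equal predecessor sets have the same height. It is not zero, since
  the root is unique, and not a limit, by the uniqueness clause of normality. So it is a successor,
  and the predecessor at the preceding height is the required \<open>w\<close>.\<close>

lemma same_predecessors_imm_succ:
  assumes "x \<in> T" "y \<in> T" "x \<noteq> y" and eq: "underS r x = underS r y"
  obtains w where "imm_succ w x" "imm_succ w y"
proof -
  obtain \<alpha> :: "nat set rel" where \<alpha>: "height_of x =o \<alpha>" "\<alpha> <o omega1"
    using level_index assms by blast
  have lev: "x \<in> tree_level T r \<alpha>" "y \<in> tree_level T r \<alpha>"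
    using assms \<alpha> by (simp_all add: tree_level_def)
  have "underS r x \<noteq> {}"
  proof
    assume "underS r x = {}"
    then have "Field \<alpha> = {}"
      using \<alpha>(1) Field_height_of[OF \<open>x \<in> T\<close>] unfolding ordIso_def iso_def bij_betw_def by auto
    then have "\<alpha> = {}"
      by (auto simp: Field_def)
    then have "card (tree_level T r \<alpha>) = 1"
      using normal by (simp add: normal_tree_def)
    then show False
      using lev \<open>x \<noteq> y\<close> by (auto simp: card_1_singleton_iff)
  qed
  then have ne: "\<alpha> \<noteq> {}"
    using \<alpha>(1) Field_height_of[OF \<open>x \<in> T\<close>] unfolding ordIso_def iso_def bij_betw_def
    by (auto simp: Field_def)
  have "\<not> limit_ord \<alpha>"
    using normal lev \<alpha> eq \<open>x \<noteq> y\<close> unfolding normal_tree_def by blast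
  then obtain \<beta> where \<beta>: "is_ord_succ \<beta> \<alpha>"
    using ne \<alpha> unfolding limit_ord_def ordLess_def by blast
  then have "\<beta> <o height_of x" "Well_order \<beta>"
    using \<alpha> ordIso_symmetric ordLess_ordIso_trans unfolding is_ord_succ_def ordLess_def
    by blast+
  \<comment> \<open>An ordinal below the height of \<open>x\<close> is the order type of an initial
    segment of the predecessors of \<open>x\<close>, cut off at some node \<open>w\<close>; this
    segment is the height of \<open>w\<close>.\<close>
  then obtain w where w: "w \<sqsubset> x" "\<beta> =o Restr (height_of x) (underS (height_of x) w)"
    using ordLess_iff_ordIso_Restr[OF Well_order_height_of[OF \<open>x \<in> T\<close>]]
      Field_height_of[OF \<open>x \<in> T\<close>] by metis
  then have \<beta>w: "\<beta> =o height_of w"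
    using height_of_restrict by simp
  have "\<not> z \<sqsubset> x" if "w \<sqsubset> z" for z
  proof
    assume "z \<sqsubset> x"
    then have "z \<in> T"
      using le_carrier by (auto simp: less_iff)
    then obtain \<gamma> :: "nat set rel" where \<gamma>: "height_of z =o \<gamma>"
      using level_index by blast
    then have "\<beta> <o \<gamma>" "\<gamma> <o \<alpha>"
      using height_of_less[OF that] height_of_less[OF \<open>z \<sqsubset> x\<close>] \<beta>w \<alpha>(1)
      by (meson ordIso_symmetric ordIso_ordLess_trans ordLess_ordIso_trans)+
    then show False
      using \<beta> unfolding is_ord_succ_def by blast
  qed
  then show ?thesis
    using that[of w] w eq unfolding imm_succ_def by blast
qed

section \<open>The lexicographic order\<close>

text \<open>The incomparable case of the lexicographic order with the meet and the two successors as
  explicit witnesses, which avoids reasoning with the description operators in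
  \<open>tree_meet\<close> and \<open>succ_towards\<close>.\<close>

definition branch_less :: "'a \<Rightarrow> 'a \<Rightarrow> 'a \<Rightarrow> 'a \<Rightarrow> 'a \<Rightarrow> bool" where
  "branch_less w s' t' s t \<longleftrightarrow>
     imm_succ w s' \<and> imm_succ w t' \<and> s' \<sqsubseteq> s \<and> t' \<sqsubseteq> t \<and> s' \<in> underS p t'"

definition lex_less :: "'a \<Rightarrow> 'a \<Rightarrow> bool" (infix "\<lless>" 50) where
  "s \<lless> t \<longleftrightarrow> s \<sqsubset> t \<or> (\<exists>w s' t'. branch_less w s' t' s t)"

text \<open>Let \<open>s'\<close> be the first node on the way to \<open>s\<close> that is not below
  \<open>t\<close>, and \<open>t'\<close> the first on the way to \<open>t\<close> that is not below
  \<open>s\<close>. Both have exactly the common predecessors of \<open>s\<close> and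
  \<open>t\<close> below them, so they share an immediate predecessor.\<close>

lemma incomp_split:
  assumes st: "s \<in> T" "t \<in> T" "incomp r s t"
  obtains w s' t' where "imm_succ w s'" "imm_succ w t'" "s' \<noteq> t'" "s' \<sqsubseteq> s" "t' \<sqsubseteq> t"
proof -
  define split where "split a b = {u. u \<sqsubseteq> a \<and> \<not> u \<sqsubseteq> b}" for a b
  have *: "\<exists>a'. a' \<sqsubseteq> a \<and> \<not> a' \<sqsubseteq> b \<and> (\<forall>u. u \<sqsubset> a' \<longrightarrow> u \<sqsubseteq> b)"
    if "a \<in> T" "\<not> a \<sqsubseteq> b" for a b
  proof -
    have "a \<in> split a b" "split a b \<subseteq> T"
      using that le_refl le_carrier by (auto simp: split_def)
    then obtain a' where "a' \<in> split a b" "\<And>z. z \<sqsubset> a' \<Longrightarrow> z \<notin> split a b"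
      using minimal_below by metis
    then show ?thesis
      unfolding split_def less_iff using le_trans by blast
  qed
  obtain s' where s': "s' \<sqsubseteq> s" "\<not> s' \<sqsubseteq> t" "\<And>u. u \<sqsubset> s' \<Longrightarrow> u \<sqsubseteq> t"
    using *[of s t] st unfolding incomp_def by blast
  obtain t' where t': "t' \<sqsubseteq> t" "\<not> t' \<sqsubseteq> s" "\<And>u. u \<sqsubset> t' \<Longrightarrow> u \<sqsubseteq> s"
    using *[of t s] st unfolding incomp_def by blast
  have "underS r s' = underS r t'"
  proof (intro equalityI subsetI)
    fix u assume u: "u \<sqsubset> s'"
    then have "u \<sqsubseteq> t" "u \<sqsubseteq> s"
      using s' le_trans unfolding less_iff by blast+
    then show "u \<sqsubset> t'"
      using comparable[of u t t'] t' le_trans unfolding less_iff by blast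
  next
    fix u assume u: "u \<sqsubset> t'"
    then have "u \<sqsubseteq> t" "u \<sqsubseteq> s"
      using t' le_trans unfolding less_iff by blast+
    then show "u \<sqsubset> s'"
      using comparable[of u s s'] s' le_trans unfolding less_iff by blast
  qed
  moreover have "s' \<noteq> t'" "s' \<in> T" "t' \<in> T"
    using s' t' le_carrier by blast+
  ultimately obtain w where "imm_succ w s'" "imm_succ w t'"
    using same_predecessors_imm_succ by blast
  then show ?thesis
    using that s' t' \<open>s' \<noteq> t'\<close> by blast
qed

lemma split_incomp:
  assumes "imm_succ w s'" "imm_succ w t'" "s' \<noteq> t'" "s' \<sqsubseteq> s" "t' \<sqsubseteq> t"
  shows "incomp r s t"
  unfolding incomp_def using assms imm_succ_unique le_trans by blast

lemma tree_meet_eq: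
  assumes "imm_succ w s'" "imm_succ w t'" "s' \<noteq> t'" "s' \<sqsubseteq> s" "t' \<sqsubseteq> t"
  shows "tree_meet r s t = w"
  unfolding tree_meet_def
proof (rule the_equality)
  have w: "w \<sqsubset> s" "w \<sqsubset> t"
    using assms less_le_trans unfolding imm_succ_def by blast+
  have max: "z \<sqsubseteq> w" if "z \<in> underS r s \<inter> underS r t" for z
  proof (rule ccontr)
    assume "\<not> z \<sqsubseteq> w"
    moreover have z: "z \<sqsubseteq> s" "z \<sqsubseteq> t" and "w \<sqsubseteq> s"
      using that w by (auto simp: less_iff)
    moreover have "z \<noteq> w"
      using \<open>\<not> z \<sqsubseteq> w\<close> z le_refl le_carrier by blast
    ultimately have "w \<sqsubset> z"
      using comparable[of z s w] unfolding less_iff by blast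
    \<comment> \<open>A common predecessor strictly beyond \<open>w\<close> would lie above both
      \<open>s'\<close> and \<open>t'\<close>, two different children of \<open>w\<close>.\<close>
    then have "s' \<sqsubseteq> z" "t' \<sqsubseteq> z"
      using imm_succ_le[of w s' s z] imm_succ_le[of w t' t z] assms z by blast+
    then show False
      using assms imm_succ_unique by blast
  qed
  then show "w \<in> underS r s \<inter> underS r t \<and> (\<forall>z\<in>underS r s \<inter> underS r t. z \<sqsubseteq> w)"
    using w by blast
  show "m = w" if "m \<in> underS r s \<inter> underS r t \<and> (\<forall>z\<in>underS r s \<inter> underS r t. z \<sqsubseteq> m)" for m
    using that max w le_antisym by blast
qed

lemma succ_towards_eq:
  assumes "imm_succ w s'" "s' \<sqsubseteq> s"
  shows "succ_towards r w s = s'"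
  unfolding succ_towards_def
proof (rule the_equality)
  show "s' \<sqsubseteq> s \<and> w \<sqsubset> s' \<and> \<not> (\<exists>z. w \<sqsubset> z \<and> z \<sqsubset> s')"
    using assms unfolding imm_succ_def by blast
  show "y = s'" if "y \<sqsubseteq> s \<and> w \<sqsubset> y \<and> \<not> (\<exists>z. w \<sqsubset> z \<and> z \<sqsubset> y)" for y
    using that assms imm_succ_unique[of w y s' s] unfolding imm_succ_def by blast
qed

lemma lex_less_carrier: "s \<lless> t \<Longrightarrow> s \<in> T \<and> t \<in> T"
  unfolding lex_less_def branch_less_def less_iff using le_carrier by blast

lemma lex_less_irrefl: "\<not> s \<lless> s"
proof
  assume "s \<lless> s"
  then obtain w s' t' where "branch_less w s' t' s s"
    unfolding lex_less_def less_iff by blast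
  then show False
    using imm_succ_unique unfolding branch_less_def underS_def by blast
qed

lemma in_lex_order_iff:
  "(s, t) \<in> lex_order T r p \<longleftrightarrow> s \<in> T \<and> t \<in> T \<and> (s = t \<or> s \<lless> t)"
proof (cases "s \<in> T \<and> t \<in> T")
  case st: True
  show ?thesis
  proof (cases "incomp r s t")
    case True
    then obtain w s' t' where w: "imm_succ w s'" "imm_succ w t'" "s' \<noteq> t'" "s' \<sqsubseteq> s" "t' \<sqsubseteq> t"
      using incomp_split st by blast
    \<comment> \<open>The branching node of any witness is the meet, so the existential in
      \<open>lex_less\<close> has only one candidate and agrees with the definition by
      descriptions.\<close>
    have uniq: "s'' = s' \<and> t'' = t'" if b: "branch_less v s'' t'' s t" for v s'' t''
    proof -
      have "v = w"
        using b w tree_meet_eq unfolding branch_less_def underS_def by blast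
      then show ?thesis
        using b w imm_succ_unique unfolding branch_less_def by blast
    qed
    have "s \<noteq> t" "\<not> s \<sqsubseteq> t"
      using True st le_refl unfolding incomp_def by auto
    then have "(s, t) \<in> lex_order T r p \<longleftrightarrow> s' \<in> underS p t'"
      unfolding lex_order_def
      using st True tree_meet_eq[OF w] succ_towards_eq w by simp
    also have "\<dots> \<longleftrightarrow> s \<lless> t"
      unfolding lex_less_def
      using w uniq \<open>\<not> s \<sqsubseteq> t\<close> unfolding branch_less_def less_iff by blast
    finally show ?thesis
      using st \<open>s \<noteq> t\<close> by blast
  next
    case False
    then have "\<not> branch_less w s' t' s t" for w s' t'
      using split_incomp unfolding branch_less_def underS_def by blast
    then show ?thesis
      using False st le_refl unfolding lex_order_def lex_less_def less_iff by auto
  qed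
qed (auto simp: lex_order_def)

lemma lex_less_total:
  assumes "s \<in> T" "t \<in> T" "s \<noteq> t"
  shows "s \<lless> t \<or> t \<lless> s"
proof (cases "incomp r s t")
  case True
  then obtain w s' t' where w: "imm_succ w s'" "imm_succ w t'" "s' \<noteq> t'" "s' \<sqsubseteq> s" "t' \<sqsubseteq> t"
    using incomp_split assms by blast
  then have "s' \<in> T" "t' \<in> T"
    using le_carrier by blast+
  then have "s' \<in> underS p t' \<or> t' \<in> underS p s'"
    using linear w(3) unfolding order_on_defs total_on_def underS_def by blast
  then show ?thesis
    using w unfolding lex_less_def branch_less_def by blast
next
  case False
  then show ?thesis
    using assms unfolding incomp_def lex_less_def less_iff by blast
qed

lemma underS_p_trans: "x \<in> underS p y \<Longrightarrow> y \<in> underS p z \<Longrightarrow> x \<in> underS p z"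
  using linear unfolding order_on_defs trans_def antisym_def underS_def by blast

lemma lex_less_trans:
  assumes "s \<lless> t" "t \<lless> u"
  shows "s \<lless> u"
proof -
  consider "s \<sqsubset> t" "t \<sqsubset> u"
    | w t' u' where "s \<sqsubset> t" "branch_less w t' u' t u"
    | w s' t' where "branch_less w s' t' s t" "t \<sqsubset> u"
    | w s' t' v t'' u' where "branch_less w s' t' s t" "branch_less v t'' u' t u"
    using assms unfolding lex_less_def by blast
  then show ?thesis
  proof cases
    case 1
    then show ?thesis
      unfolding lex_less_def using less_le_trans less_iff by blast
  next
    case 2
    \<comment> \<open>Either \<open>s\<close> already contains the branch \<open>t'\<close>, and the
      same split separates \<open>s\<close> from \<open>u\<close>, or \<open>s\<close> is at or
      below the splitting node \<open>w\<close> and hence below \<open>u\<close> in the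
      tree.\<close>
    show ?thesis
    proof (cases "t' \<sqsubseteq> s")
      case True
      then show ?thesis
        using 2 unfolding lex_less_def branch_less_def by blast
    next
      case False
      have "\<not> w \<sqsubset> s"
        using False 2 imm_succ_le[of w t' t s] unfolding branch_less_def less_iff by blast
      moreover have "w \<sqsubseteq> t" "s \<sqsubseteq> t"
        using 2 le_trans unfolding branch_less_def imm_succ_def less_iff by blast+
      ultimately have "s \<sqsubseteq> w"
        using comparable unfolding less_iff by blast
      then have "s \<sqsubset> u"
        using 2 le_less_trans less_le_trans unfolding branch_less_def imm_succ_def by blast
      then show ?thesis
        unfolding lex_less_def by blast
    qed
  next
    case 3
    then show ?thesis
      using le_trans unfolding lex_less_def branch_less_def less_iff by blast
  next
    case 4
    then have w: "imm_succ w s'" "imm_succ w t'" "s' \<sqsubseteq> s" "t' \<sqsubseteq> t" "s' \<in> underS p t'"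
      and v: "imm_succ v t''" "imm_succ v u'" "t'' \<sqsubseteq> t" "u' \<sqsubseteq> u" "t'' \<in> underS p u'"
      unfolding branch_less_def by blast+
    have wt: "w \<sqsubset> t" "v \<sqsubset> t" "w \<sqsubset> s" "v \<sqsubset> u"
      using w v less_le_trans unfolding imm_succ_def by blast+
    \<comment> \<open>Both splitting nodes lie below \<open>t\<close> and are therefore comparable;
      the lower one decides between \<open>s\<close> and \<open>u\<close>, and if they coincide,
      transitivity of \<open>p\<close> does.\<close>
    then consider "w = v" | "w \<sqsubset> v" | "v \<sqsubset> w"
      using comparable unfolding less_iff by blast
    then show ?thesis
    proof cases
      case 1
      then have "t' = t''"
        using w v imm_succ_unique by blast
      then have "branch_less w s' u' s u"
        using 1 w v underS_p_trans unfolding branch_less_def by blast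
      then show ?thesis
        unfolding lex_less_def by blast
    next
      case 2
      then have "t' \<sqsubseteq> v"
        using imm_succ_le[OF w(2,4)] wt by (simp add: less_iff)
      then have "t' \<sqsubseteq> u"
        using wt le_trans unfolding less_iff by blast
      then have "branch_less w s' t' s u"
        using w unfolding branch_less_def by blast
      then show ?thesis
        unfolding lex_less_def by blast
    next
      case 3
      then have "t'' \<sqsubseteq> w"
        using imm_succ_le[OF v(1,3)] wt by (simp add: less_iff)
      then have "t'' \<sqsubseteq> s"
        using wt le_trans unfolding less_iff by blast
      then have "branch_less v t'' u' s u"
        using v unfolding branch_less_def by blast
      then show ?thesis
        unfolding lex_less_def by blast
    qed
  qed
qed

section \<open>Cones and closed sets\<close>

definition nonleast_child :: "'a \<Rightarrow> 'a \<Rightarrow> bool" where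
  "nonleast_child w z \<longleftrightarrow> imm_succ w z \<and> (\<exists>z'. imm_succ w z' \<and> z' \<in> underS p z)"

lemma exists_nonleast_child:
  assumes "w \<in> T"
  obtains z where "nonleast_child w z"
proof -
  obtain y0 y1 where y: "imm_succ w y0" "imm_succ w y1" "y0 \<noteq> y1"
    using two_imm_succs assms by blast
  then have "y0 \<in> T" "y1 \<in> T"
    using le_carrier unfolding imm_succ_def less_iff by blast+
  then have "y0 \<in> underS p y1 \<or> y1 \<in> underS p y0"
    using linear y(3) unfolding order_on_defs total_on_def underS_def by blast
  then show ?thesis
    using y that unfolding nonleast_child_def by blast
qed

abbreviation lex_topology :: "'a topology" where
  "lex_topology \<equiv> order_topology_on T (lex_order T r p)"

lemma topspace_lex: "topspace lex_topology = T"
  unfolding order_topology_on_def topology_generated_by_topspace underS_def aboveS_def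
  by (auto simp: in_lex_order_iff)

section \<open>Neighbourhoods of non-least children\<close>

text \<open>The point \<open>e\<close> ensures that \<open>z\<close> is not the least element. It
  serves as the left endpoint for the subbasic sets that impose no lower bound, namely
  \<open>T\<close> and the left rays.\<close>

lemma open_contains_left_interval:
  assumes "openin lex_topology U" "z \<in> U" and "e \<lless> z"
  obtains a where "a \<lless> z" "\<And>t. a \<lless> t \<Longrightarrow> t \<lless> z \<Longrightarrow> t \<in> U"
proof -
  have "generate_topology_on
      (insert T (underS (lex_order T r p) ` T \<union> aboveS (lex_order T r p) ` T)) U"
    using assms(1) unfolding order_topology_on_def by (rule openin_topology_generated_by)
  then have "z \<in> U \<Longrightarrow> \<exists>a. a \<lless> z \<and> (\<forall>t. a \<lless> t \<longrightarrow> t \<lless> z \<longrightarrow> t \<in> U)"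
  proof induction
    case (Int U V)
    then obtain a b where "a \<lless> z" "\<forall>t. a \<lless> t \<longrightarrow> t \<lless> z \<longrightarrow> t \<in> U"
      and "b \<lless> z" "\<forall>t. b \<lless> t \<longrightarrow> t \<lless> z \<longrightarrow> t \<in> V"
      by blast
    \<comment> \<open>The larger of the two endpoints serves for the intersection.\<close>
    then show ?case
      using lex_less_total[of a b] lex_less_trans lex_less_carrier by (metis IntI)
  next
    case (Basis B)
    then consider "B = T" | b where "b \<in> T" "B = underS (lex_order T r p) b"
      | b where "b \<in> T" "B = aboveS (lex_order T r p) b"
      by blast
    then show ?case
    proof cases
      case 1
      then show ?thesis
        using assms(3) lex_less_carrier by blast
    next
      case 2
      then have "z \<lless> b"
        using Basis by (auto simp: underS_def in_lex_order_iff)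
      then have "t \<in> B" if "t \<lless> z" for t
        using lex_less_trans[OF that] lex_less_irrefl lex_less_carrier 2
        by (auto simp: underS_def in_lex_order_iff)
      then show ?thesis
        using assms(3) by blast
    next
      case 3
      then have "b \<lless> z"
        using Basis by (auto simp: aboveS_def in_lex_order_iff)
      moreover have "t \<in> B" if "b \<lless> t" for t
        using that lex_less_irrefl lex_less_carrier 3
        by (auto simp: aboveS_def in_lex_order_iff)
      ultimately show ?thesis
        by blast
    qed
  qed blast+
  then show ?thesis
    using that assms(2) by blast
qed

text \<open>Let \<open>a\<close> be the left endpoint of an interval ending at \<open>z\<close>
  inside \<open>U\<close>. Cones above smaller siblings of \<open>z\<close> lie to the left of
  \<open>z\<close>, so it remains to find one, or a smaller cone inside one, that lies to the right
  of \<open>a\<close>.\<close>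

lemma open_contains_cone:
  assumes U: "openin lex_topology U" "z \<in> U" and z: "nonleast_child w z"
  obtains c where "w \<sqsubset> c" "\<And>t. c \<sqsubseteq> t \<Longrightarrow> t \<in> U"
proof -
  obtain z' where wz: "imm_succ w z" and z': "imm_succ w z'" "z' \<in> underS p z"
    using z unfolding nonleast_child_def by blast
  have zT: "z \<in> T" "z' \<in> T"
    using wz z' le_carrier unfolding imm_succ_def less_iff by blast+
  have left: "t \<lless> z" if "imm_succ w y" "y \<sqsubseteq> t" "y \<in> underS p z" for y t
    using that wz zT le_refl unfolding lex_less_def branch_less_def by blast
  note cone = that
  obtain a where a: "a \<lless> z" "\<And>t. a \<lless> t \<Longrightarrow> t \<lless> z \<Longrightarrow> t \<in> U"
    using open_contains_left_interval[OF U left[OF z'(1) le_refl z'(2)]] zT by metis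
  \<comment> \<open>If everything strictly above \<open>w\<close> is to the right of
    \<open>a\<close>, the whole cone of the smaller sibling \<open>z'\<close> fits into the
    interval.\<close>
  have via_z': ?thesis if above_w: "\<And>t. w \<sqsubset> t \<Longrightarrow> a \<lless> t"
  proof (rule cone[of z'])
    show "w \<sqsubset> z'"
      using z' by (simp add: imm_succ_def)
    then show "t \<in> U" if "z' \<sqsubseteq> t" for t
      using a(2) left[OF z'(1) that z'(2)] less_le_trans that above_w by blast
  qed
  have below_z: "v \<sqsubseteq> w" if "v \<sqsubset> z" for v
    using that wz comparable[of v z w] unfolding imm_succ_def less_iff by blast
  consider "a \<sqsubset> z" | v a' z'' where "branch_less v a' z'' a z"
    using a(1) unfolding lex_less_def by blast
  then show ?thesis
  proof cases
    case 1
    then show ?thesis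
      using via_z' below_z le_less_trans unfolding lex_less_def by blast
  next
    case 2
    then have "v \<sqsubset> z"
      using less_le_trans unfolding branch_less_def imm_succ_def by blast
    then have "v = w \<or> v \<sqsubset> w"
      using below_z unfolding less_iff by blast
    then show ?thesis
    proof
      \<comment> \<open>Here \<open>a\<close> lies in the cone of a smaller sibling
        \<open>a'\<close> of \<open>z\<close>, so the cone of \<open>z'\<close> need not be to the
        right of \<open>a\<close>. The cone of a child of \<open>a\<close> is, and it stays to the
        left of \<open>z\<close>.\<close>
      assume "v = w"
      then have "z'' = z"
        using 2 wz zT le_refl imm_succ_unique unfolding branch_less_def by blast
      obtain c where c: "imm_succ a c"
        using two_imm_succs lex_less_carrier[OF a(1)] by blast
      show ?thesis
      proof (rule that[of c])
        have "w \<sqsubset> a'" "a' \<sqsubseteq> a" "a \<sqsubset> c"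
          using 2 c \<open>v = w\<close> unfolding branch_less_def imm_succ_def by blast+
        then show "w \<sqsubset> c"
          using less_le_trans less_iff by blast
        show "t \<in> U" if "c \<sqsubseteq> t" for t
        proof -
          have "a \<sqsubset> t"
            using \<open>a \<sqsubset> c\<close> that less_le_trans by blast
          moreover have "t \<lless> z"
            using left[of a' t] 2 \<open>v = w\<close> \<open>z'' = z\<close> \<open>a \<sqsubset> t\<close> le_trans
            unfolding branch_less_def less_iff by blast
          ultimately show ?thesis
            using a(2) unfolding lex_less_def by blast
        qed
      qed
    next
      \<comment> \<open>Now \<open>a\<close> branches off below \<open>w\<close>, hence precedes
        everything above \<open>w\<close>.\<close>
      assume "v \<sqsubset> w"
      then have "z'' \<sqsubseteq> w"
        using 2 wz imm_succ_le[of v z'' z w] unfolding branch_less_def imm_succ_def less_iff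
        by blast
      then show ?thesis
        using 2 via_z' le_trans unfolding lex_less_def branch_less_def less_iff by blast
    qed
  qed
qed

section \<open>Co-countable sets of nodes and the countable strongly dense set\<close>

definition minimal :: "'a set \<Rightarrow> 'a set" where
  "minimal D = {m \<in> D. \<forall>z. z \<sqsubset> m \<longrightarrow> z \<notin> D}"

lemma countable_minimal:
  assumes "D \<subseteq> T"
  shows "countable (minimal D)"
proof (rule countable_antichain)
  show "minimal D \<subseteq> T"
    using assms by (auto simp: minimal_def)
  show "pairwise (incomp r) (minimal D)"
    unfolding pairwise_def incomp_def minimal_def less_iff by blast
qed

text \<open>Every node outside \<open>D\<close> lies strictly below a minimal element of
  \<open>D\<close>. There are countably many of these, each with countably many
  predecessors.\<close>

lemma countable_Diff_dense_upward_closed: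
  assumes "D \<subseteq> T"
    and dense: "\<And>y. y \<in> T \<Longrightarrow> \<exists>c\<in>D. y \<sqsubseteq> c"
    and up: "\<And>x y. x \<in> D \<Longrightarrow> x \<sqsubseteq> y \<Longrightarrow> y \<in> D"
  shows "countable (T - D)"
proof -
  have "T - D \<subseteq> (\<Union>m\<in>minimal D. underS r m)"
  proof
    fix x assume x: "x \<in> T - D"
    then obtain c where c: "c \<in> D" "x \<sqsubseteq> c"
      using dense by blast
    then obtain m where m: "m \<in> D" "m \<sqsubseteq> c" "\<And>z. z \<sqsubset> m \<Longrightarrow> z \<notin> D"
      using minimal_below \<open>D \<subseteq> T\<close> by metis
    \<comment> \<open>Both nodes are below \<open>c\<close>, and \<open>m\<close> below
      \<open>x\<close> would put \<open>x\<close> into \<open>D\<close> by upward closure.\<close>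
    then have "x \<sqsubset> m"
      using comparable[OF c(2) m(2)] up x unfolding less_iff by blast
    then show "x \<in> (\<Union>m\<in>minimal D. underS r m)"
      using m unfolding minimal_def by blast
  qed
  moreover have "countable (\<Union>m\<in>minimal D. underS r m)"
    using countable_minimal[OF \<open>D \<subseteq> T\<close>] countable_below by blast
  ultimately show ?thesis
    using countable_subset by blast
qed

text \<open>
  The more natural dichotomy ``the cone of \<open>y\<close> lies in \<open>F\<close> or misses \<open>F\<close>'' need not be dense:
  if \<open>p\<close> is a well-order, every cone contains isolated points of the line, and \<open>F\<close> may omit some
  of these. Testing only non-least children, which are never isolated, avoids this.
\<close>

definition deciding :: "'a set \<Rightarrow> 'a set" where
  "deciding F = {y \<in> T. (\<forall>t. y \<sqsubseteq> t \<longrightarrow> t \<notin> F) \<or>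
     (\<forall>w z. y \<sqsubseteq> w \<and> nonleast_child w z \<longrightarrow> z \<in> F)}"

lemma countable_not_deciding:
  assumes F: "closedin lex_topology F"
  shows "countable (T - deciding F)"
proof (rule countable_Diff_dense_upward_closed)
  show "deciding F \<subseteq> T"
    by (auto simp: deciding_def)
  show "y \<in> deciding F" if "x \<in> deciding F" "x \<sqsubseteq> y" for x y
    using that le_trans le_carrier unfolding deciding_def by blast
  show "\<exists>c\<in>deciding F. y \<sqsubseteq> c" if y: "y \<in> T" for y
  proof (cases "y \<in> deciding F")
    case True
    then show ?thesis
      using y le_refl by blast
  next
    case False
    \<comment> \<open>Failure of the second alternative yields a non-least child in the open
      complement of \<open>F\<close>. That complement then contains a whole cone above
      \<open>w\<close>, whose base satisfies the first alternative.\<close>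
    then obtain w z where wz: "y \<sqsubseteq> w" "nonleast_child w z" "z \<notin> F"
      using y unfolding deciding_def by blast
    have "z \<in> T"
      using wz le_carrier unfolding nonleast_child_def imm_succ_def less_iff by blast
    moreover have "openin lex_topology (T - F)"
      using F topspace_lex by (metis closedin_def)
    ultimately obtain c where c: "w \<sqsubset> c" "\<And>t. c \<sqsubseteq> t \<Longrightarrow> t \<in> T - F"
      using open_contains_cone wz by (metis DiffI)
    then have "c \<in> deciding F" "y \<sqsubseteq> c"
      using wz le_trans le_carrier unfolding deciding_def less_iff by blast+
    then show ?thesis
      by blast
  qed
qed

theorem exponentially_separable_lex: "exponentially_separable lex_topology"
  unfolding exponentially_separable_def topspace_lex
proof (intro allI impI, elim conjE)
  fix \<F> :: "'a set set"
  assume "countable \<F>" and closed: "\<forall>C\<in>\<F>. closedin lex_topology C"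
  define E where "E = {x \<in> T. \<forall>F\<in>\<F>. x \<in> deciding F}"
  have "\<forall>w\<in>T. \<exists>z. nonleast_child w z"
    using exists_nonleast_child by blast
  then obtain child where child: "\<And>w. w \<in> T \<Longrightarrow> nonleast_child w (child w)"
    by metis
  define A where "A = (T - E) \<union> child ` minimal E"
  have "countable (\<Union>F\<in>\<F>. T - deciding F)"
    by (rule countable_UN[OF \<open>countable \<F>\<close>]) (use closed countable_not_deciding in blast)
  moreover have "T - E = (\<Union>F\<in>\<F>. T - deciding F)"
    unfolding E_def by blast
  ultimately have "countable (T - E)"
    by simp
  moreover have "countable (minimal E)"
    by (rule countable_minimal) (auto simp: E_def)
  ultimately have "countable A"
    unfolding A_def by simp
  moreover have "A \<subseteq> T"
    using child le_carrier
    unfolding A_def E_def minimal_def nonleast_child_def imm_succ_def less_iff by blast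
  moreover have "strongly_dense_in lex_topology \<F> A"
    unfolding strongly_dense_in_def topspace_lex
  proof (intro allI impI, elim conjE)
    fix \<G> assume "\<G> \<subseteq> \<F>" "T \<inter> \<Inter>\<G> \<noteq> {}"
    then obtain x where x: "x \<in> T" "\<And>F. F \<in> \<G> \<Longrightarrow> x \<in> F"
      by blast
    show "A \<inter> (T \<inter> \<Inter>\<G>) \<noteq> {}"
    proof (cases "x \<in> E")
      case True
      \<comment> \<open>The node \<open>u\<close> depends only on \<open>x\<close>, so its chosen
        child can serve all members of \<open>\<G>\<close> simultaneously.\<close>
      then obtain u where u: "u \<in> E" "u \<sqsubseteq> x" "\<And>z. z \<sqsubset> u \<Longrightarrow> z \<notin> E"
        using minimal_below[of x E] by (auto simp: E_def)
      then have uT: "u \<in> T"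
        by (simp add: E_def)
      have "child u \<in> F" if "F \<in> \<G>" for F
      proof -
        \<comment> \<open>Since \<open>x\<close> is in \<open>F\<close> and above \<open>u\<close>,
          the cone of \<open>u\<close> meets \<open>F\<close>; hence the second alternative of
          \<open>deciding\<close> holds at \<open>u\<close> and applies to the child of
          \<open>u\<close> itself.\<close>
        have "u \<in> deciding F" "x \<in> F"
          using u x that \<open>\<G> \<subseteq> \<F>\<close> by (auto simp: E_def)
        then show ?thesis
          using child[OF uT] le_refl[OF uT] u(2) unfolding deciding_def by blast
      qed
      moreover have "child u \<in> A"
        using u unfolding A_def minimal_def by blast
      ultimately show ?thesis
        using \<open>A \<subseteq> T\<close> by blast
    next
      case False
      \<comment> \<open>A point outside \<open>E\<close> belongs to \<open>A\<close> and is its own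
        witness.\<close>
      then show ?thesis
        using x unfolding A_def by blast
    qed
  qed
  ultimately show "\<exists>A. A \<subseteq> T \<and> countable A \<and> strongly_dense_in lex_topology \<F> A"
    by blast
qed

end

theorem theorem9:
  fixes T :: "'a set" and r p :: "'a rel"
  assumes "souslin_tree T r"
    and "normal_tree T r omega1"
    and "linear_order_on T p"
  shows "functionally_countable (order_topology_on T (lex_order T r p)) \<and>
    exponentially_separable (order_topology_on T (lex_order T r p))"
proof -
  interpret souslin_lex T r p
    using assms by unfold_locales
  show ?thesis
    using exponentially_separable_lex exponentially_separable_imp_functionally_countable by blast
qed

end
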